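(* Let $\mathbf{E}=\{N_1=1<N_2<\cdots<N_k<\cdots\}$ be a URI-set with its elements listed in increasing order. For all real numbers $\alpha,\beta$ with $1\le\alpha<\beta<10$, $$\lim_{k\to\infty}\mathbb{P}\bigl(\mathscr{M}(N_k)\in[\alpha,\beta]\bigr)=\mu^{\mathrm{B}}([\alpha,\beta]).$$
   Context: A URI-set is a random set $\mathbf{E}$ of positive integers such that each integer $n\ge1$ belongs to $\mathbf{E}$ with probability $1/n$, the events $(n\in\mathbf{E})$, $n\ge1$, being independent; almost surely $\mathbf{E}$ is infinite. For a positive real number $x$, the mantissa $\mathscr{M}(x)$ is the unique real number in $[1,10)$ such that $x=\mathscr{M}(x)\,10^k$ for some integer $k$. $\mu^{\mathrm{B}}$ is the probability distribution on $[1,10)$ (Benford's law) defined by $\mu^{\mathrm{B}}([1,t]):=\log_{10}t$ for $1\le t<10$; thus $\mu^{\mathrm{B}}([\alpha,\beta])=\log_{10}\beta-\log_{10}\alpha$. *)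

theory Defs
  imports "HOL-Probability.Probability"
begin

text \<open>The measurability of the events \<open>n \<in> E\<close> is part of \<open>indep_events\<close>.\<close>

locale URI_set = prob_space M for M :: "'a measure" +
  fixes E :: "'a \<Rightarrow> nat set"
  assumes positive: "\<And>\<omega>. \<omega> \<in> space M \<Longrightarrow> 0 \<notin> E \<omega>"
    and indep: "indep_events (\<lambda>n. {\<omega> \<in> space M. n \<in> E \<omega>}) {1..}"
    and prob_mem: "\<And>n. n \<ge> 1 \<Longrightarrow> prob {\<omega> \<in> space M. n \<in> E \<omega>} = 1 / real n"

text \<open>
  \<open>URI_nth E k\<close> is the element \<open>N\<^sub>k\<close> in the increasing listing \<open>N\<^sub>1 < N\<^sub>2 < \<dots>\<close> of the random set;
  \<open>enumerate\<close> counts from 0, hence the shift (the index \<open>k = 0\<close> carries no meaning).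
  On the null event that \<open>E \<omega>\<close> is finite, its value is arbitrary for large \<open>k\<close>.
\<close>

definition URI_nth :: "('a \<Rightarrow> nat set) \<Rightarrow> nat \<Rightarrow> 'a \<Rightarrow> nat" where
  "URI_nth E k \<omega> = enumerate (E \<omega>) (k - 1)"

definition decimal_mantissa :: "real \<Rightarrow> real" where
  "decimal_mantissa x = (THE m. m \<in> {1..<10} \<and> (\<exists>k::int. x = m * 10 powi k))"

lemma decimal_mantissa_ex1:
  assumes "x > 0"
  shows "\<exists>!m. m \<in> {1..<10::real} \<and> (\<exists>k::int. x = m * 10 powi k)"
proof (rule ex_ex1I)
  define k where "k = \<lfloor>log 10 x\<rfloor>"
  define m where "m = x * 10 powi (- k)"
  have "x = 10 powr log 10 x"
    using assms by simp
  hence "m = 10 powr (log 10 x - of_int k)"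
    unfolding m_def by (simp add: powr_real_of_int' [symmetric] powr_diff powr_minus divide_inverse)
  moreover have "0 \<le> log 10 x - of_int k" "log 10 x - of_int k < 1"
    unfolding k_def by linarith+
  ultimately have "m \<in> {1..<10}"
    using powr_mono[of 0 "log 10 x - of_int k" "10::real"]
      powr_less_mono[of "log 10 x - of_int k" 1 "10::real"] by simp
  moreover have "x = m * 10 powi k"
    unfolding m_def by (simp add: power_int_minus)
  ultimately show "\<exists>m. m \<in> {1..<10::real} \<and> (\<exists>k::int. x = m * 10 powi k)"
    by blast
next
  fix m m' :: real
  assume "m \<in> {1..<10} \<and> (\<exists>k::int. x = m * 10 powi k)"
    and "m' \<in> {1..<10} \<and> (\<exists>k::int. x = m' * 10 powi k)"
  then obtain k k' :: int where *: "m \<in> {1..<10}" "m' \<in> {1..<10}"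
      "x = m * 10 powi k" "x = m' * 10 powi k'" by blast
  have log_eq: "log 10 x = log 10 n + of_int j" if "n \<in> {1..<10}" "x = n * 10 powi j" for n and j :: int
    using that by (simp add: log_mult powr_real_of_int' [symmetric])
  have log_bds: "0 \<le> log 10 n" "log 10 n < 1" if "n \<in> {1..<10}" for n :: real
    using that by auto
  have "\<lfloor>log 10 x\<rfloor> = k"
    using log_eq[OF *(1,3)] log_bds[OF *(1)] by linarith
  moreover have "\<lfloor>log 10 x\<rfloor> = k'"
    using log_eq[OF *(2,4)] log_bds[OF *(2)] by linarith
  ultimately have "k = k'"
    by simp
  thus "m = m'"
    using *(3,4) by auto
qed

text \<open>
  Benford's law on \<open>[1, 10)\<close>: the measure with distribution function \<open>t \<mapsto> log\<^sub>1\<^sub>0 t\<close>,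
  constructed by restricting the corresponding Stieltjes measure on the real line.
\<close>

definition benford_cdf :: "real \<Rightarrow> real" where
  "benford_cdf t = (if t < 1 then 0 else if t < 10 then log 10 t else 1)"

definition benford :: "real measure" where
  "benford = restrict_space (interval_measure benford_cdf) {1..<10}"

lemma benford_cdf_alt: "benford_cdf t = log 10 (max 1 (min 10 t))"
  by (auto simp: benford_cdf_def max_def min_def)

lemma benford_cdf_mono: "s \<le> t \<Longrightarrow> benford_cdf s \<le> benford_cdf t"
  unfolding benford_cdf_alt by (subst log_le_cancel_iff) auto

lemma continuous_on_benford_cdf: "continuous_on A benford_cdf"
  unfolding benford_cdf_alt log_def by (intro continuous_intros) auto

lemma measure_benford_Icc:
  assumes "1 \<le> \<alpha>" "\<alpha> \<le> \<beta>" "\<beta> < 10"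
  shows "measure benford {\<alpha>..\<beta>} = log 10 \<beta> - log 10 \<alpha>"
proof -
  have "measure benford {\<alpha>..\<beta>} = measure (interval_measure benford_cdf) {\<alpha>..\<beta>}"
    unfolding benford_def using assms by (intro measure_restrict_space) auto
  also have "\<dots> = benford_cdf \<beta> - benford_cdf \<alpha>"
    unfolding measure_def
    using assms benford_cdf_mono continuous_on_benford_cdf[of UNIV]
    by (subst emeasure_interval_measure_Icc) auto
  finally show ?thesis
    using assms by (simp add: benford_cdf_def)
qed

corollary measure_benford_1: "1 \<le> t \<Longrightarrow> t < 10 \<Longrightarrow> measure benford {1..t} = log 10 t"
  by (simp add: measure_benford_Icc)

end

theory Submission
  imports Defs "HOL-Combinatorics.Stirling"
begin

text \<open>
  The proof is a computation with the exact law of \<open>N\<^sub>k\<close>, followed by a summation by parts.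

  The number of elements of the random set among the first \<open>n\<close> integers is a sum of independent
  Bernoulli variables with parameters \<open>1, 1/2, \<dots>, 1/n\<close>. It therefore equals \<open>k\<close> with probability
  \<open>count_prob n k = stirling n k / n!\<close>, the law of the number of cycles of a uniform random
  permutation. The event that \<open>n + 1\<close> is the \<open>(k+1)\<close>-st element says that \<open>n + 1\<close> is chosen and
  that exactly \<open>k\<close> elements precede it, so its probability is \<open>count_prob n k / (n + 1)\<close>.
  Thus the law of \<open>N\<^sub>k\<^sub>+\<^sub>1\<close> is the logarithmic weight \<open>1/(n+1)\<close> times a density
  \<open>n \<mapsto> count_prob n k\<close> (\<open>prob_URI_nth_sums\<close>).

  Two facts then give Benford's law. First, the integers with mantissa in \<open>[\<alpha>, \<beta>]\<close> have
  logarithmic density \<open>log\<^sub>1\<^sub>0 (\<beta>/\<alpha>)\<close> with a \<^emph>\<open>bounded\<close> error: each decade contributes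
  \<open>ln (\<beta>/\<alpha>)\<close> to the harmonic sum up to an error decreasing geometrically
  (\<open>benford_defect_partial_sums_bounded\<close>). Second, the density \<open>n \<mapsto> count_prob n k\<close> is flat:
  its total variation tends to \<open>0\<close> as \<open>k\<close> grows. Summation by parts (\<open>abel_summation_bound\<close>)
  bounds the difference between the probability and its limit by a constant times the supremum
  and the variation of the density (\<open>weighted_count_prob_Benford\<close>).

  Flatness has two ingredients. Convolution with a Bernoulli law keeps a sequence unimodal and
  moves its mode by at most one step to the right; since the sign of
  \<open>count_prob (n+1) k - count_prob n k\<close> depends on the side of the mode of row \<open>n\<close> on which \<open>k\<close>
  lies, the density rises and then falls, and its variation is at most twice its supremum
  (\<open>count_prob_variation\<close>). The supremum tends to \<open>0\<close> because the sum of squares of row \<open>n\<close> does: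
  convolution with a Bernoulli law acts as one step of a heat flow, which dissipates this energy
  at a rate controlled from below by a power of the energy itself, and the total time
  \<open>\<Sum> 1/n\<close> is infinite (\<open>energy_tendsto_0\<close>).
\<close>

section \<open>The law of the number of elements among the first integers\<close>

text \<open>
  The probability that a uniform random permutation of \<open>n\<close> points has \<open>k\<close> cycles; equivalently,
  the law of a sum of \<open>n\<close> independent Bernoulli variables with parameters \<open>1/i\<close>, \<open>1 \<le> i \<le> n\<close>,
  as the recursion \<open>count_prob_Suc_Suc\<close> below shows.
\<close>

definition count_prob :: "nat \<Rightarrow> nat \<Rightarrow> real" where
  "count_prob n k = real (stirling n k) / fact n"

lemma count_prob_nonneg: "0 \<le> count_prob n k"
  by (simp add: count_prob_def)

lemma count_prob_eq_0: "n < k \<Longrightarrow> count_prob n k = 0"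
  by (simp add: count_prob_def)

lemma count_prob_0: "count_prob 0 k = (if k = 0 then 1 else 0)"
  by (cases k) (simp_all add: count_prob_def)

lemma count_prob_Suc_0: "count_prob (Suc n) 0 = 0"
  by (simp add: count_prob_def)

lemma count_prob_Suc_Suc:
  "count_prob (Suc n) (Suc k) =
    (1 - 1 / real (Suc n)) * count_prob n (Suc k) + 1 / real (Suc n) * count_prob n k"
proof -
  have "real n * s / ((1 + real n) * f) = (1 - 1 / (1 + real n)) * (s / f)" if "f > 0" for s f :: real
    using that by (simp add: divide_simps)
  from this[of "fact n"] show ?thesis
    by (simp add: count_prob_def add_divide_distrib)
qed

lemma sum_count_prob: "(\<Sum>k\<le>n. count_prob n k) = 1"
  unfolding count_prob_def sum_divide_distrib[symmetric] of_nat_sum[symmetric] sum_stirling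
  by simp

text \<open>
  The change from one row to the next is the discrete slope of the old row: this identity turns
  information about a row as a function of \<open>k\<close> into information about a column as a function of \<open>n\<close>.
\<close>

lemma count_prob_increment:
  "count_prob (Suc n) (Suc k) - count_prob n (Suc k) =
    (count_prob n k - count_prob n (Suc k)) / real (Suc n)"
  by (simp add: count_prob_Suc_Suc diff_divide_distrib left_diff_distrib)

section \<open>Decay of the row maxima\<close>

text \<open>
  The square sum of a row plays the role of an energy, decreased by each convolution step. It
  bounds the square of every entry, which is why its decay is what is needed.
\<close>

definition energy :: "nat \<Rightarrow> real" where
  "energy n = (\<Sum>k\<le>n. (count_prob n k)\<^sup>2)"

definition dissipation :: "nat \<Rightarrow> real" where
  "dissipation n = (\<Sum>k\<le>n. (count_prob n (Suc k) - count_prob n k)\<^sup>2)"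

text \<open>
  Row \<open>n \<ge> 1\<close> vanishes at \<open>0\<close> (because \<open>1\<close> is always chosen) and beyond \<open>n\<close>, so shifting the index
  loses nothing.
\<close>

lemma energy_shift:
  assumes "n \<ge> 1"
  shows "(\<Sum>k\<le>n. (count_prob n (Suc k))\<^sup>2) = energy n"
proof -
  obtain m where n: "n = Suc m" using assms by (cases n) auto
  have "(\<Sum>k\<le>n. (count_prob n (Suc k))\<^sup>2) = (\<Sum>k\<le>m. (count_prob n (Suc k))\<^sup>2)"
    by (simp add: n count_prob_eq_0)
  also have "\<dots> = energy n"
    using sum.atMost_Suc_shift[of "\<lambda>k. (count_prob n k)\<^sup>2" m]
    by (simp add: energy_def n count_prob_Suc_0)
  finally show ?thesis .
qed

text \<open>
  With \<open>q = 1/(n+1)\<close>, the new row is the average \<open>(1 - q) x + q y\<close> of the old row and its shift, and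
  \<open>((1 - q) x + q y)\<^sup>2 = (1 - q) x\<^sup>2 + q y\<^sup>2 - q (1 - q) (x - y)\<^sup>2\<close>.
\<close>

lemma energy_Suc:
  assumes "n \<ge> 1"
  shows "energy (Suc n) =
    energy n - 1 / real (Suc n) * (1 - 1 / real (Suc n)) * dissipation n"
proof -
  define q where "q = 1 / real (Suc n)"
  have sq: "((1 - q) * x + q * y)\<^sup>2 = (1 - q) * x\<^sup>2 + q * y\<^sup>2 - q * (1 - q) * (x - y)\<^sup>2" for x y
    by (simp add: power2_eq_square algebra_simps)
  have "energy (Suc n) = (\<Sum>k\<le>n. ((1 - q) * count_prob n (Suc k) + q * count_prob n k)\<^sup>2)"
    unfolding energy_def q_def
    by (subst sum.atMost_Suc_shift) (simp only: count_prob_Suc_0 count_prob_Suc_Suc, simp)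
  also have "\<dots> = (1 - q) * (\<Sum>k\<le>n. (count_prob n (Suc k))\<^sup>2) + q * energy n - q * (1 - q) * dissipation n"
    unfolding sq energy_def dissipation_def by (simp add: sum.distrib sum_subtractf sum_distrib_left)
  finally show ?thesis
    unfolding energy_shift[OF assms] q_def by (simp add: algebra_simps)
qed

lemma energy_nonneg: "0 \<le> energy n"
  unfolding energy_def by (simp add: sum_nonneg)

lemma dissipation_nonneg: "0 \<le> dissipation n"
  unfolding dissipation_def by (simp add: sum_nonneg)

lemma count_prob_le_1: "count_prob n k \<le> 1"
proof (cases "k \<le> n")
  case True
  then have "count_prob n k \<le> (\<Sum>k\<le>n. count_prob n k)"
    by (intro member_le_sum) (auto simp: count_prob_nonneg)
  then show ?thesis by (simp add: sum_count_prob)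
qed (simp add: count_prob_eq_0)

lemma count_prob_sq_le_energy: "(count_prob n k)\<^sup>2 \<le> energy n"
proof (cases "k \<le> n")
  case True
  then show ?thesis unfolding energy_def by (intro member_le_sum) auto
qed (simp add: count_prob_eq_0 energy_nonneg)

lemma energy_le:
  assumes "\<And>k. count_prob n k \<le> b"
  shows "energy n \<le> b"
proof -
  have "energy n \<le> (\<Sum>k\<le>n. b * count_prob n k)"
    unfolding energy_def power2_eq_square
    by (intro sum_mono mult_right_mono assms count_prob_nonneg)
  then show ?thesis by (simp add: sum_distrib_left[symmetric] sum_count_prob)
qed

text \<open>
  A discrete Agmon inequality: telescoping the squares from the zero at index \<open>0\<close> writes an entry
  squared as a sum of \<open>(c\<^sub>i\<^sub>+\<^sub>1 - c\<^sub>i) (c\<^sub>i\<^sub>+\<^sub>1 + c\<^sub>i)\<close>, and Cauchy-Schwarz separates the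
  differences from the entries, whose energy is at most \<open>1\<close>.
\<close>

lemma count_prob_pow4_le:
  assumes "n \<ge> 1"
  shows "count_prob n k ^ 4 \<le> 4 * dissipation n"
proof (cases "k \<le> n")
  case True
  let ?c = "count_prob n"
  have "?c 0 = 0"
    using assms by (cases n) (simp_all add: count_prob_Suc_0)
  then have "(?c k)\<^sup>2 = (\<Sum>i<k. (?c (Suc i))\<^sup>2 - (?c i)\<^sup>2)"
    using sum_lessThan_telescope[of "\<lambda>i. (?c i)\<^sup>2" k] by simp
  also have "\<dots> = (\<Sum>i<k. (?c (Suc i) - ?c i) * (?c (Suc i) + ?c i))"
    by (intro sum.cong) (simp_all add: power2_eq_square algebra_simps)
  finally have "((?c k)\<^sup>2)\<^sup>2 \<le> (\<Sum>i<k. (?c (Suc i) - ?c i)\<^sup>2) * (\<Sum>i<k. (?c (Suc i) + ?c i)\<^sup>2)"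
    by (simp only: Cauchy_Schwarz_ineq_sum)
  also have "\<dots> \<le> dissipation n * 4"
  proof (rule mult_mono)
    show "(\<Sum>i<k. (?c (Suc i) - ?c i)\<^sup>2) \<le> dissipation n"
      unfolding dissipation_def using True by (intro sum_mono2) auto
    have "(\<Sum>i<k. (?c (Suc i) + ?c i)\<^sup>2) \<le> (\<Sum>i\<le>n. (?c (Suc i) + ?c i)\<^sup>2)"
      using True by (intro sum_mono2) auto
    also have "\<dots> \<le> (\<Sum>i\<le>n. 2 * (?c (Suc i))\<^sup>2 + 2 * (?c i)\<^sup>2)"
    proof (rule sum_mono)
      show "(?c (Suc i) + ?c i)\<^sup>2 \<le> 2 * (?c (Suc i))\<^sup>2 + 2 * (?c i)\<^sup>2" for i
        using zero_le_power2[of "?c (Suc i) - ?c i"]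
        by (simp add: power2_eq_square algebra_simps)
    qed
    also have "\<dots> = 4 * energy n"
      using energy_shift[OF assms] by (simp add: sum.distrib sum_distrib_left[symmetric] energy_def)
    also have "\<dots> \<le> 4"
      using energy_le[OF count_prob_le_1] by simp
    finally show "(\<Sum>i<k. (?c (Suc i) + ?c i)\<^sup>2) \<le> 4" .
  qed (auto intro: dissipation_nonneg sum_nonneg)
  finally show ?thesis
    by (simp add: power_mult[symmetric])
qed (simp add: count_prob_eq_0 dissipation_nonneg)

text \<open>
  A discrete Nash inequality: because a row has mass \<open>1\<close>, its energy is at most its largest entry,
  so a row of large energy also dissipates energy fast.
\<close>

lemma energy_pow4_le:
  assumes "n \<ge> 1"
  shows "energy n ^ 4 \<le> 4 * dissipation n"
proof -
  have "count_prob n k \<le> root 4 (4 * dissipation n)" for k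
    using real_root_le_mono[OF _ count_prob_pow4_le[OF assms, of k], of 4]
    by (simp add: real_root_power_cancel count_prob_nonneg)
  from energy_le[OF this] have "energy n ^ 4 \<le> root 4 (4 * dissipation n) ^ 4"
    by (intro power_mono energy_nonneg)
  then show ?thesis
    by (simp add: dissipation_nonneg)
qed

lemma energy_decay:
  assumes "n \<ge> 1"
  shows "energy n ^ 4 / 8 * (1 / real (Suc n)) \<le> energy n - energy (Suc n)"
proof -
  have "energy n ^ 4 / 8 * (1 / real (Suc n)) \<le> (1/2) * dissipation n * (1 / real (Suc n))"
    using energy_pow4_le[OF assms] by (intro mult_right_mono) simp_all
  also have "\<dots> = 1 / real (Suc n) * ((1/2) * dissipation n)"
    by simp
  also have "\<dots> \<le> 1 / real (Suc n) * ((1 - 1 / real (Suc n)) * dissipation n)"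
    using assms by (intro mult_left_mono mult_right_mono dissipation_nonneg) (auto simp: field_simps)
  also have "\<dots> = energy n - energy (Suc n)"
    by (simp add: energy_Suc[OF assms])
  finally show ?thesis .
qed

text \<open>
  If the decreasing energy had a positive limit \<open>u\<close>, the steps of \<open>energy_decay\<close> would each remove
  at least \<open>(u\<^sup>4/8) / (n+1)\<close>, and the harmonic series would converge.
\<close>

lemma energy_tendsto_0: "energy \<longlonglongrightarrow> 0"
proof -
  have dec: "decseq (\<lambda>n. energy (Suc n))"
  proof (rule decseq_SucI)
    show "energy (Suc (Suc n)) \<le> energy (Suc n)" for n
      using energy_decay[of "Suc n"] energy_nonneg[of "Suc n"]
      by (smt (verit) divide_nonneg_nonneg le_add1 mult_nonneg_nonneg of_nat_0_le_iff plus_1_eq_Suc zero_le_power)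
  qed
  then obtain u where u: "(\<lambda>n. energy (Suc n)) \<longlonglongrightarrow> u" and ge: "\<And>n. u \<le> energy (Suc n)"
    using decseq_convergent[OF dec, of 0] energy_nonneg by blast
  have "u \<ge> 0"
    using u energy_nonneg by (intro LIMSEQ_le_const[OF u]) auto
  moreover have False if "u > 0"
  proof -
    have "summable (\<lambda>n. 8 / u ^ 4 * (energy (Suc n) - energy (Suc (Suc n))))"
      using telescope_summable'[OF u] by (intro summable_mult)
    moreover have "norm (inverse (real (Suc (Suc n)))) \<le> 8 / u ^ 4 * (energy (Suc n) - energy (Suc (Suc n)))" for n
    proof -
      have "u ^ 4 / 8 * (1 / real (Suc (Suc n))) \<le> energy (Suc n) ^ 4 / 8 * (1 / real (Suc (Suc n)))"
        using that by (intro mult_right_mono divide_right_mono power_mono ge) auto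
      also have "\<dots> \<le> energy (Suc n) - energy (Suc (Suc n))"
        by (rule energy_decay) simp
      finally have "8 / u ^ 4 * (u ^ 4 / 8 * (1 / real (Suc (Suc n)))) \<le> 8 / u ^ 4 * (energy (Suc n) - energy (Suc (Suc n)))"
        using that by (intro mult_left_mono) auto
      moreover have "8 / u ^ 4 * (u ^ 4 / 8 * x) = x" for x
        using that by simp
      ultimately show ?thesis by (simp only: inverse_eq_divide) simp
    qed
    ultimately have "summable (\<lambda>n. inverse (real (Suc (Suc n))))"
      by (rule summable_comparison_test'[where N = 0]) 
    then have "summable (\<lambda>n. inverse (real n))"
      using summable_Suc_iff[of "\<lambda>n. inverse (real n)"] summable_Suc_iff[of "\<lambda>n. inverse (real (Suc n))"] by simp
    then show False using not_summable_harmonic[where 'a = real] by simp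
  qed
  ultimately have "u = 0" by fastforce
  with u show ?thesis by (simp add: filterlim_sequentially_Suc)
qed

lemma count_prob_uniformly_small:
  assumes "\<epsilon> > 0"
  shows "\<forall>\<^sub>F k in sequentially. \<forall>n j. n \<ge> k \<longrightarrow> count_prob n j \<le> \<epsilon>"
proof -
  have "\<forall>\<^sub>F n in sequentially. energy n < \<epsilon>\<^sup>2"
    using assms by (intro order_tendstoD(2)[OF energy_tendsto_0]) simp
  then obtain K where K: "\<And>n. n \<ge> K \<Longrightarrow> energy n < \<epsilon>\<^sup>2"
    by (auto simp: eventually_sequentially)
  have "count_prob n j \<le> \<epsilon>" if "n \<ge> K" for n j
    using count_prob_sq_le_energy[of n j] K[OF that] assms
    by - (rule power2_le_imp_le, linarith, simp)
  then show ?thesis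
    unfolding eventually_sequentially by (auto intro!: exI[of _ K])
qed

section \<open>Unimodality and total variation in the number of trials\<close>

text \<open>
  Averaging a unimodal sequence with its shift by one leaves it increasing up to the old mode and
  decreasing from one place after it; the one undecided step determines whether the mode stays or
  moves by one. In particular the modes can be chosen monotone in \<open>n\<close>.
\<close>

lemma row_mode_exists:
  "\<exists>m. mono m \<and> (\<forall>n k. (k < m n \<longrightarrow> count_prob n k \<le> count_prob n (Suc k)) \<and>
                     (m n \<le> k \<longrightarrow> count_prob n (Suc k) \<le> count_prob n k))"
proof -
  let ?mode = "\<lambda>n m. \<forall>k. (k < m \<longrightarrow> count_prob n k \<le> count_prob n (Suc k)) \<and>
                     (m \<le> k \<longrightarrow> count_prob n (Suc k) \<le> count_prob n k)"
  have "\<exists>m. \<forall>n. ?mode n (m n) \<and> m n \<le> m (Suc n)"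
  proof (rule dependent_nat_choice)
    show "\<exists>m. ?mode 0 m"
      by (intro exI[of _ 0]) (simp add: count_prob_0)
  next
    fix m n assume mode: "?mode n m"
    define q where "q = 1 / real (Suc n)"
    have q: "0 \<le> q" "0 \<le> 1 - q" by (auto simp: q_def)
    have rec: "count_prob (Suc n) (Suc j) = (1 - q) * count_prob n (Suc j) + q * count_prob n j" for j
      unfolding q_def by (rule count_prob_Suc_Suc)
    have up: "count_prob (Suc n) j \<le> count_prob (Suc n) (Suc j)" if "j < m" for j
    proof (cases j)
      case 0
      then show ?thesis by (simp add: count_prob_Suc_0 count_prob_nonneg)
    next
      case (Suc i)
      with mode that have "count_prob n j \<le> count_prob n (Suc j)" "count_prob n i \<le> count_prob n j"
        by auto
      then show ?thesis using q unfolding Suc rec by (intro add_mono mult_left_mono) auto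
    qed
    have down: "count_prob (Suc n) (Suc j) \<le> count_prob (Suc n) j" if j: "m < j" for j
    proof -
      obtain i where i: "j = Suc i" "m \<le> i" using j by (cases j) auto
      with mode have "count_prob n (Suc j) \<le> count_prob n j" "count_prob n j \<le> count_prob n i"
        by auto
      then show ?thesis using q unfolding i rec by (intro add_mono mult_left_mono) auto
    qed
    show "\<exists>m'. ?mode (Suc n) m' \<and> m \<le> m'"
    proof (cases "count_prob (Suc n) m \<le> count_prob (Suc n) (Suc m)")
      case True
      then show ?thesis using up down
        by (intro exI[of _ "Suc m"]) (auto simp: less_Suc_eq)
    next
      case False
      then show ?thesis using up down
        by (intro exI[of _ m]) (auto simp: le_less)
    qed
  qed
  then show ?thesis by (metis mono_iff_le_Suc)
qed

text \<open>
  Here \<open>P\<close> holds during the rising phase. A rise and a subsequent fall between \<open>0\<close> and \<open>b\<close> each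
  contribute at most \<open>b\<close>.
\<close>

lemma variation_le_if_unimodal:
  fixes f :: "nat \<Rightarrow> real"
  assumes rise: "\<And>n. P n \<Longrightarrow> f n \<le> f (Suc n)"
    and fall: "\<And>n. \<not> P n \<Longrightarrow> f (Suc n) \<le> f n"
    and once: "\<And>n. P (Suc n) \<Longrightarrow> P n"
    and bounds: "\<And>n. 0 \<le> f n" "\<And>n. f n \<le> b"
  shows "(\<Sum>n<N. \<bar>f (Suc n) - f n\<bar>) \<le> 2 * b"
proof -
  \<comment> \<open>While falling, the variation left over is bounded by the current height, hence the term \<open>- f N\<close>.\<close>
  have "(P N \<longrightarrow> (\<Sum>n<N. \<bar>f (Suc n) - f n\<bar>) \<le> f N) \<and>
        (\<not> P N \<longrightarrow> (\<Sum>n<N. \<bar>f (Suc n) - f n\<bar>) \<le> 2 * b - f N)"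
  proof (induction N)
    case 0
    then show ?case using bounds[of 0] by auto
  next
    case (Suc N)
    then show ?case
      using rise[of N] fall[of N] once[of N] bounds[of "Suc N"] by (cases "P N") auto
  qed
  then show ?thesis using bounds[of N] by (smt (verit))
qed

text \<open>
  By \<open>count_prob_increment\<close> the column rises at \<open>n\<close> as long as the mode of row \<open>n\<close> is at most
  \<open>k - 1\<close>; as the modes are monotone, once it falls it falls for ever.
\<close>

lemma count_prob_variation:
  assumes "\<And>n. count_prob n k \<le> b" "k \<ge> 1"
  shows "(\<Sum>n<N. \<bar>count_prob (Suc n) k - count_prob n k\<bar>) \<le> 2 * b"
proof -
  obtain i where k: "k = Suc i" using assms(2) by (cases k) auto
  obtain m where m: "mono m" "\<And>n j. j < m n \<Longrightarrow> count_prob n j \<le> count_prob n (Suc j)"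
      "\<And>n j. m n \<le> j \<Longrightarrow> count_prob n (Suc j) \<le> count_prob n j"
    using row_mode_exists by blast
  show ?thesis
  proof (rule variation_le_if_unimodal[where P = "\<lambda>n. m n \<le> i"])
    fix n
    show "count_prob n k \<le> count_prob (Suc n) k" if "m n \<le> i"
    proof -
      have "0 \<le> (count_prob n i - count_prob n (Suc i)) / real (Suc n)"
        using m(3)[OF that] by simp
      then show ?thesis using count_prob_increment[of n i] unfolding k by simp
    qed
    show "count_prob (Suc n) k \<le> count_prob n k" if "\<not> m n \<le> i"
    proof -
      have "(count_prob n i - count_prob n (Suc i)) / real (Suc n) \<le> 0"
        using m(2)[of i n] that by (intro divide_nonpos_nonneg) auto
      then show ?thesis using count_prob_increment[of n i] unfolding k by simp
    qed
    show "m n \<le> i" if "m (Suc n) \<le> i"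
      using that monoD[OF m(1), of n "Suc n"] by simp
  qed (auto simp: count_prob_nonneg assms)
qed

section \<open>Total mass of the weights\<close>

text \<open>
  The probability of at most \<open>k\<close> successes drops at trial \<open>i + 1\<close> exactly by the probability that
  there were \<open>k\<close> successes before and the trial succeeds; the sum telescopes.
\<close>

lemma sum_count_prob_weighted:
  "(\<Sum>i<N. count_prob i k / real (Suc i)) = 1 - (\<Sum>j\<le>k. count_prob N j)"
proof (induction N)
  case 0
  then show ?case by (simp add: count_prob_0)
next
  case (Suc N)
  have "(\<Sum>j\<le>k. count_prob (Suc N) j) = (\<Sum>j\<le>k. count_prob N j) - count_prob N k / real (Suc N)"
  proof (induction k)
    case 0
    show ?case
      by (cases N) (auto simp: count_prob_Suc_0 count_prob_0)
  next
    case (Suc k)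
    then show ?case using count_prob_increment[of N k] by (simp add: diff_divide_distrib)
  qed
  with Suc show ?case by simp
qed

text \<open>
  Each fixed count becomes improbable as the number of trials grows, so the telescoped sum has
  limit \<open>1\<close>. In terms of the random set: it almost surely has more than \<open>k\<close> elements.
\<close>

lemma count_prob_weighted_sums_1: "(\<lambda>i. count_prob i k / real (Suc i)) sums 1"
proof -
  have "(\<lambda>n. count_prob n j) \<longlonglongrightarrow> 0" for j
  proof (rule Lim_null_comparison)
    show "(\<lambda>n. sqrt (energy n)) \<longlonglongrightarrow> 0"
      using tendsto_real_sqrt[OF energy_tendsto_0] by simp
    show "\<forall>\<^sub>F n in sequentially. norm (count_prob n j) \<le> sqrt (energy n)"
      by (simp add: count_prob_nonneg real_le_rsqrt count_prob_sq_le_energy)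
  qed
  then have "(\<lambda>N. 1 - (\<Sum>j\<le>k. count_prob N j)) \<longlonglongrightarrow> 1 - (\<Sum>j\<le>k. 0)"
    by (intro tendsto_intros)
  then show ?thesis unfolding sums_def sum_count_prob_weighted by simp
qed

section \<open>Logarithmic density of the integers with prescribed mantissa\<close>

lemma decimal_mantissa_eq:
  assumes "10 ^ j \<le> x" "x < 10 ^ Suc j"
  shows "decimal_mantissa x = x / 10 ^ j"
proof -
  have "x > 0" using assms(1) by (smt (verit) zero_less_power)
  have "x / 10 ^ j \<in> {1..<10} \<and> (\<exists>k::int. x = x / 10 ^ j * 10 powi k)"
    using assms by (auto simp: divide_simps intro!: exI[of _ "int j"])
  then show ?thesis
    unfolding decimal_mantissa_def
    by (rule the1_equality[OF decimal_mantissa_ex1[OF \<open>x > 0\<close>]])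
qed

lemma ln_Suc_bounds:
  assumes "i \<ge> 1"
  shows "ln (real (Suc i)) - ln (real i) \<le> 1 / real i"
    and "1 / real (Suc i) \<le> ln (real (Suc i)) - ln (real i)"
proof -
  have "ln (real (Suc i)) - ln (real i) = ln (real (Suc i) / real i)"
    using assms by (simp add: ln_divide_pos)
  also have "real (Suc i) / real i = 1 + 1 / real i"
    using assms by (simp add: field_simps)
  also have "ln (1 + 1 / real i) \<le> 1 / real i" using assms by (intro ln_add_one_self_le_self) simp
  finally show "ln (real (Suc i)) - ln (real i) \<le> 1 / real i" .
  have "ln (real i) - ln (real (Suc i)) = ln (real i / real (Suc i))"
    using assms by (simp add: ln_divide_pos)
  also have "real i / real (Suc i) = 1 - 1 / real (Suc i)"
    by (simp add: field_simps)
  also have "ln (1 - 1 / real (Suc i)) \<le> - (1 / real (Suc i))"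
    using assms ln_add_one_self_le_self2[of "- (1 / real (Suc i))"] by simp
  finally show "1 / real (Suc i) \<le> ln (real (Suc i)) - ln (real i)" by simp
qed

lemma sum_inverse_bounds:
  assumes "1 \<le> p" "p \<le> q"
  shows "ln (real q) - ln (real p) \<le> (\<Sum>i=p..<q. 1 / real i)"
    and "(\<Sum>i=p..<q. 1 / real i) \<le> ln (real q) - ln (real p) + 1 / real p - 1 / real q"
  using assms(2)
proof (induction q rule: dec_induct)
  case (step q)
  {
    case 1
    show ?case using step ln_Suc_bounds(1)[of q] assms(1) by simp
  next
    case 2
    show ?case using step ln_Suc_bounds(2)[of q] assms(1) by simp
  }
qed simp_all

text \<open>
  The end points are rounded to integers, which moves each logarithm by at most \<open>1/a\<close>; the
  comparison of the harmonic sum with the logarithm costs another \<open>1/a\<close>, in the direction opposite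
  to the error at the left end, so \<open>2/a\<close> is enough.
\<close>

lemma sum_inverse_real_interval:
  fixes a b :: real
  assumes "1 \<le> a" "a \<le> b"
  shows "\<bar>(\<Sum>i | a \<le> real i \<and> real i \<le> b. 1 / real i) - (ln b - ln a)\<bar> \<le> 2 / a"
proof -
  define p where "p = nat \<lceil>a\<rceil>"
  define q where "q = Suc (nat \<lfloor>b\<rfloor>)"
  have set: "{i. a \<le> real i \<and> real i \<le> b} = {p..<q}"
    using assms unfolding p_def q_def by (auto simp: nat_le_iff ceiling_le_iff le_nat_iff le_floor_iff less_Suc_eq_le)
  have p: "a \<le> real p" "real p \<le> a + 1" and q: "b \<le> real q" "real q \<le> b + 1"
    using assms unfolding p_def q_def by linarith+
  have "1 \<le> p" "p \<le> q"
    using assms unfolding p_def q_def by linarith+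
  note bounds = sum_inverse_bounds[OF this]
  have ln_le: "ln y - ln x \<le> 1 / x" if "x > 0" "x \<le> y" "y \<le> x + 1" for x y :: real
  proof -
    have "ln y - ln x \<le> (y - x) / x"
      using that by (intro ln_diff_le) auto
    also have "\<dots> \<le> 1 / x" using that by (intro divide_right_mono) auto
    finally show ?thesis .
  qed
  have "ln a \<le> ln (real p)" "ln b \<le> ln (real q)"
    using assms p q by auto
  moreover have "ln (real p) - ln a \<le> 1 / a" "ln (real q) - ln b \<le> 1 / b"
    using assms p q by (auto intro!: ln_le)
  moreover have "1 / b \<le> 1 / a" "1 / real p \<le> 1 / a"
    using assms p by (simp_all add: frac_le)
  moreover have "0 \<le> 1 / real q" "0 \<le> 1 / a"
    using assms by simp_all
  moreover have "2 / a = 1 / a + 1 / a" by simp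
  ultimately show ?thesis
    using bounds unfolding set by linarith
qed

text \<open>
  The term at \<open>i\<close> of the harmonic sum restricted to the integers with mantissa in \<open>[\<alpha>, \<beta>]\<close>, minus
  what a set of logarithmic density exactly \<open>log\<^sub>1\<^sub>0 (\<beta>/\<alpha>)\<close> should contribute. The value at
  \<open>i = 0\<close> is \<open>0\<close>, as division by zero gives.
\<close>

definition benford_defect :: "real \<Rightarrow> real \<Rightarrow> nat \<Rightarrow> real" where
  "benford_defect \<alpha> \<beta> i =
    ((if decimal_mantissa (real i) \<in> {\<alpha>..\<beta>} then 1 else 0) - (log 10 \<beta> - log 10 \<alpha>)) / real i"

context
  fixes \<alpha> \<beta> :: real
  assumes \<alpha>\<beta>: "1 \<le> \<alpha>" "\<alpha> \<le> \<beta>" "\<beta> < 10"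
begin

lemma benford_mass_bounds: "0 \<le> log 10 \<beta> - log 10 \<alpha>" "log 10 \<beta> - log 10 \<alpha> \<le> 1"
proof -
  have "log 10 \<alpha> \<ge> 0" "log 10 \<beta> \<le> 1" "log 10 \<alpha> \<le> log 10 \<beta>"
    using \<alpha>\<beta> by auto
  then show "0 \<le> log 10 \<beta> - log 10 \<alpha>" "log 10 \<beta> - log 10 \<alpha> \<le> 1" by linarith+
qed

text \<open>
  Within the decade starting at \<open>10\<^sup>j\<close>, the integers with mantissa in \<open>[\<alpha>, \<beta>]\<close> are those between
  \<open>\<alpha> 10\<^sup>j\<close> and \<open>\<beta> 10\<^sup>j\<close>. Their reciprocals add up to about \<open>ln (\<beta>/\<alpha>)\<close>, all reciprocals of
  the decade to about \<open>ln 10\<close>, and the two main terms cancel.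
\<close>

lemma benford_defect_decade:
  "\<bar>\<Sum>i = 10 ^ j..<10 ^ Suc j. benford_defect \<alpha> \<beta> i\<bar> \<le> 3 / 10 ^ j"
proof -
  define L where "L = log 10 \<beta> - log 10 \<alpha>"
  define T :: real where "T = 10 ^ j"
  have T: "T \<ge> 1" by (simp add: T_def)
  let ?D = "{10 ^ j..<10 ^ Suc j} :: nat set"
  have dec: "10 ^ j \<le> i \<longleftrightarrow> T \<le> real i" "i < 10 ^ Suc j \<longleftrightarrow> real i < 10 * T" for i
    using of_nat_le_iff[of "10 ^ j" i, where 'a = real]
      of_nat_less_iff[of i "10 ^ Suc j", where 'a = real] by (simp_all add: T_def)
  have mant: "decimal_mantissa (real i) = real i / T" if "i \<in> ?D" for i
  proof -
    have "T \<le> real i" "real i < 10 * T"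
      using that dec[of i] by auto
    then show ?thesis
      unfolding T_def by (intro decimal_mantissa_eq) simp_all
  qed
  have "T \<le> \<alpha> * T" "\<beta> * T < 10 * T"
    using \<alpha>\<beta> T by auto
  then have set: "{i \<in> ?D. decimal_mantissa (real i) \<in> {\<alpha>..\<beta>}} =
      {i. \<alpha> * T \<le> real i \<and> real i \<le> \<beta> * T}"
  proof (intro Collect_cong)
    fix i :: nat
    have "i \<in> ?D" if "\<alpha> * T \<le> real i" "real i \<le> \<beta> * T"
    proof -
      have "T \<le> real i" "real i < 10 * T"
        using that \<open>T \<le> \<alpha> * T\<close> \<open>\<beta> * T < 10 * T\<close> by linarith+
      then show ?thesis using dec[of i] by simp
    qed
    moreover have "real i / T \<in> {\<alpha>..\<beta>} \<longleftrightarrow> \<alpha> * T \<le> real i \<and> real i \<le> \<beta> * T"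
      using T by (simp add: pos_le_divide_eq pos_divide_le_eq)
    ultimately show "(i \<in> ?D \<and> decimal_mantissa (real i) \<in> {\<alpha>..\<beta>}) \<longleftrightarrow>
        (\<alpha> * T \<le> real i \<and> real i \<le> \<beta> * T)"
      using mant[of i] by auto
  qed
  \<comment> \<open>the reciprocals in the selected part of the decade, and in the whole decade\<close>
  define X where "X = (\<Sum>i | \<alpha> * T \<le> real i \<and> real i \<le> \<beta> * T. 1 / real i)"
  define Y where "Y = (\<Sum>i\<in>?D. 1 / real i)"
  have "(\<Sum>i\<in>?D. benford_defect \<alpha> \<beta> i) =
      (\<Sum>i\<in>?D. (if decimal_mantissa (real i) \<in> {\<alpha>..\<beta>} then 1 / real i else 0) - L * (1 / real i))"
    by (intro sum.cong) (auto simp: benford_defect_def L_def diff_divide_distrib)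
  also have "\<dots> = X - L * Y"
    unfolding X_def Y_def set[symmetric]
    by (subst sum.inter_filter) (simp_all add: sum_subtractf sum_distrib_left)
  finally have eq: "(\<Sum>i\<in>?D. benford_defect \<alpha> \<beta> i) = X - L * Y" .
  have "1 \<le> \<alpha> * T" "\<alpha> * T \<le> \<beta> * T"
    using \<alpha>\<beta> T \<open>T \<le> \<alpha> * T\<close> by (auto intro: order_trans)
  note X = sum_inverse_real_interval[OF this, folded X_def]
  have ab: "ln (\<beta> * T) - ln (\<alpha> * T) = L * ln 10"
    using \<alpha>\<beta> T by (simp add: ln_mult L_def log_def left_diff_distrib)
  have aT: "2 / (\<alpha> * T) \<le> 2 / T" "1 / (\<alpha> * T) \<le> 1 / T"
    using \<alpha>\<beta> T \<open>T \<le> \<alpha> * T\<close> by (auto intro!: divide_left_mono)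
  have lnT: "ln (real (10 ^ Suc j)) - ln (real (10 ^ j)) = ln 10"
    by (simp add: ln_mult ln_realpow algebra_simps)
  have "ln 10 \<le> Y" "Y \<le> ln 10 + 1 / T"
    using sum_inverse_bounds[of "10 ^ j" "10 ^ Suc j", folded Y_def, unfolded lnT] zero_le_divide_1_iff[of "real (10 ^ Suc j)"]
    by (auto simp: T_def)
  then have "L * ln 10 \<le> L * Y" "L * Y \<le> L * ln 10 + L * (1 / T)"
    using benford_mass_bounds unfolding L_def[symmetric] distrib_left[symmetric]
    by (auto intro!: mult_left_mono)
  moreover have "L * (1 / T) \<le> 1 / T"
    using benford_mass_bounds T unfolding L_def[symmetric] by (intro mult_left_le_one_le) auto
  moreover have "3 / T = 2 / T + 1 / T" "0 \<le> 1 / T" using T by simp_all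
  ultimately have "\<bar>X - L * Y\<bar> \<le> 3 / T"
    using X aT unfolding ab by linarith
  then show ?thesis unfolding eq T_def .
qed

lemma benford_defect_abs_le: "\<bar>benford_defect \<alpha> \<beta> i\<bar> \<le> 1 / real i"
  unfolding benford_defect_def abs_divide abs_of_nat
  using benford_mass_bounds by (intro divide_right_mono) auto

text \<open>
  The constant \<open>4\<close> makes the induction close: the errors \<open>3/10\<^sup>i\<close> of the decades form a geometric
  series with sum below \<open>4\<close>, and the bound keeps room for the remaining ones.
\<close>

lemma benford_defect_power_10:
  "\<bar>\<Sum>i<10 ^ j. benford_defect \<alpha> \<beta> i\<bar> \<le> 4 * (1 - 1 / 10 ^ j)"
proof (induction j)
  case 0
  then show ?case by (simp add: benford_defect_def)
next
  case (Suc j)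
  have "(\<Sum>i<10 ^ Suc j. benford_defect \<alpha> \<beta> i) =
      (\<Sum>i<10 ^ j. benford_defect \<alpha> \<beta> i) + (\<Sum>i = 10 ^ j..<10 ^ Suc j. benford_defect \<alpha> \<beta> i)"
    unfolding lessThan_atLeast0 by (rule sum.atLeastLessThan_concat[symmetric]) simp_all
  then have "\<bar>\<Sum>i<10 ^ Suc j. benford_defect \<alpha> \<beta> i\<bar> \<le> 4 * (1 - 1 / 10 ^ j) + 3 / 10 ^ j"
    using Suc benford_defect_decade[of j] by linarith
  also have "\<dots> \<le> 4 * (1 - 1 / 10 ^ Suc j)"
    by (simp add: divide_simps)
  finally show ?case .
qed

text \<open>
  Complete decades contribute at most \<open>4\<close>; the last, incomplete one has fewer than \<open>9 \<cdot> 10\<^sup>j\<close> terms,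
  each at most \<open>1/10\<^sup>j\<close>.
\<close>

lemma benford_defect_partial_sums_bounded:
  "\<bar>\<Sum>i<n. benford_defect \<alpha> \<beta> i\<bar> \<le> 13"
proof (cases "n = 0")
  case False
  then obtain j where j: "10 ^ j \<le> n" "n < 10 ^ Suc j"
    using ex_power_ivl1[of 10 n] by auto
  have "(\<Sum>i<n. benford_defect \<alpha> \<beta> i) =
      (\<Sum>i<10 ^ j. benford_defect \<alpha> \<beta> i) + (\<Sum>i = 10 ^ j..<n. benford_defect \<alpha> \<beta> i)"
    unfolding lessThan_atLeast0 by (rule sum.atLeastLessThan_concat[symmetric]) (use j in simp_all)
  moreover have "\<bar>\<Sum>i = 10 ^ j..<n. benford_defect \<alpha> \<beta> i\<bar> \<le> 9"
  proof -
    have "\<bar>\<Sum>i = 10 ^ j..<n. benford_defect \<alpha> \<beta> i\<bar> \<le> (\<Sum>i = 10 ^ j..<n. \<bar>benford_defect \<alpha> \<beta> i\<bar>)"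
      by (rule sum_abs)
    also have "\<dots> \<le> (\<Sum>i = 10 ^ j..<n. 1 / 10 ^ j)"
    proof (rule sum_mono)
      fix i assume "i \<in> {10 ^ j..<n}"
      then have "(10::real) ^ j \<le> real i"
        using of_nat_mono[of "10 ^ j" i, where 'a = real] by simp
      then have "1 / real i \<le> 1 / 10 ^ j"
        by (intro divide_left_mono mult_pos_pos) (auto intro: less_le_trans[of _ "10 ^ j"])
      then show "\<bar>benford_defect \<alpha> \<beta> i\<bar> \<le> 1 / 10 ^ j"
        using benford_defect_abs_le[of i] by linarith
    qed
    also have "\<dots> = (real n - 10 ^ j) / 10 ^ j"
      using j by (simp add: of_nat_diff)
    also have "\<dots> \<le> 9"
      using of_nat_less_iff[of n "10 ^ Suc j", where 'a = real] j by (simp add: divide_simps)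
    finally show ?thesis .
  qed
  moreover have "4 * (1 - 1 / 10 ^ j) \<le> (4::real)" by simp
  ultimately show ?thesis using benford_defect_power_10[of j] by linarith
qed simp

end

section \<open>Summation by parts\<close>

text \<open>
  A weight with bounded partial sums has almost no effect when integrated against a small
  function of small variation.
\<close>

lemma abel_summation_bound:
  fixes f w :: "nat \<Rightarrow> real"
  assumes W: "\<And>n. \<bar>\<Sum>i<n. w i\<bar> \<le> C"
    and f: "\<And>n. \<bar>f n\<bar> \<le> b"
    and var: "\<And>n. (\<Sum>i<n. \<bar>f (Suc i) - f i\<bar>) \<le> V"
  shows "\<bar>\<Sum>i<n. f i * w i\<bar> \<le> C * (b + V)"
proof -
  let ?W = "\<lambda>n. \<Sum>i<n. w i"
  have C: "C \<ge> 0" using W[of 0] by simp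
  have "(\<Sum>i<n. f i * w i) = f n * ?W n - (\<Sum>i<n. (f (Suc i) - f i) * ?W (Suc i))"
    by (induction n) (simp_all add: algebra_simps)
  also have "\<bar>\<dots>\<bar> \<le> \<bar>f n * ?W n\<bar> + \<bar>\<Sum>i<n. (f (Suc i) - f i) * ?W (Suc i)\<bar>"
    by (rule abs_triangle_ineq4)
  also have "\<bar>f n * ?W n\<bar> \<le> b * C"
    unfolding abs_mult using f[of n] W[of n] C by (intro mult_mono) auto
  also have "\<bar>\<Sum>i<n. (f (Suc i) - f i) * ?W (Suc i)\<bar> \<le> (\<Sum>i<n. \<bar>f (Suc i) - f i\<bar> * C)"
    by (intro order_trans[OF sum_abs] sum_mono) (simp only: abs_mult, intro mult_left_mono W, simp)
  also have "\<dots> \<le> V * C"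
    unfolding sum_distrib_right[symmetric] using C by (intro mult_right_mono var)
  finally show ?thesis by (simp add: algebra_simps)
qed

text \<open>
  The total mass of the weights \<open>count_prob i k / (i+1)\<close> is \<open>1\<close>, so subtracting \<open>log\<^sub>1\<^sub>0 (\<beta>/\<alpha>)\<close>
  from the sum amounts to replacing the indicator of the mantissa event by the Benford defect.
  The constant is \<open>13\<close> (bound of the defect sums) times \<open>1 + 2\<close> (supremum and variation).
\<close>

lemma weighted_count_prob_Benford:
  assumes "1 \<le> \<alpha>" "\<alpha> \<le> \<beta>" "\<beta> < 10" "k \<ge> 1" "\<And>n. count_prob n k \<le> b"
    and "(\<lambda>i. (if decimal_mantissa (real (Suc i)) \<in> {\<alpha>..\<beta>} then count_prob i k / real (Suc i) else 0)) sums s"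
  shows "\<bar>s - (log 10 \<beta> - log 10 \<alpha>)\<bar> \<le> 39 * b"
proof -
  define L where "L = log 10 \<beta> - log 10 \<alpha>"
  have "(\<lambda>i. (if decimal_mantissa (real (Suc i)) \<in> {\<alpha>..\<beta>} then count_prob i k / real (Suc i) else 0)
      - L * (count_prob i k / real (Suc i))) sums (s - L * 1)"
    by (intro sums_diff assms sums_mult count_prob_weighted_sums_1)
  also have "(\<lambda>i. (if decimal_mantissa (real (Suc i)) \<in> {\<alpha>..\<beta>} then count_prob i k / real (Suc i) else 0)
      - L * (count_prob i k / real (Suc i))) = (\<lambda>i. count_prob i k * benford_defect \<alpha> \<beta> (Suc i))"
    by (auto simp: fun_eq_iff benford_defect_def L_def diff_divide_distrib algebra_simps add_divide_distrib)
  finally have "(\<lambda>n. \<bar>\<Sum>i<n. count_prob i k * benford_defect \<alpha> \<beta> (Suc i)\<bar>) \<longlonglongrightarrow> \<bar>s - L\<bar>"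
    unfolding sums_def by (intro tendsto_rabs) simp
  moreover have "\<bar>\<Sum>i<n. count_prob i k * benford_defect \<alpha> \<beta> (Suc i)\<bar> \<le> 13 * (b + 2 * b)" for n
  proof (rule abel_summation_bound)
    show "\<bar>\<Sum>i<n. benford_defect \<alpha> \<beta> (Suc i)\<bar> \<le> 13" for n
      using benford_defect_partial_sums_bounded[OF assms(1-3), of "Suc n"]
      by (simp only: sum.lessThan_Suc_shift) (simp add: benford_defect_def)
    show "\<bar>count_prob n k\<bar> \<le> b" for n
      using assms(5)[of n] by (simp add: count_prob_nonneg)
    show "(\<Sum>i<n. \<bar>count_prob (Suc i) k - count_prob i k\<bar>) \<le> 2 * b" for n
      by (intro count_prob_variation assms)
  qed
  ultimately have "\<bar>s - L\<bar> \<le> 13 * (b + 2 * b)"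
    by (intro LIMSEQ_le_const2) auto
  then show ?thesis by (simp add: L_def)
qed

section \<open>Listing a set of natural numbers\<close>

text \<open>
  The characterisation by the number of predecessors is what makes the law of \<open>N\<^sub>k\<close> accessible. It
  covers finite sets as well, hence every outcome that has a \<open>k\<close>-th element.
\<close>

lemma enumerate_eq_if_card:
  fixes S :: "nat set"
  assumes "n \<in> S" "card (S \<inter> {..<n}) = i"
  shows "enumerate S i = n"
  using assms
proof (induction i arbitrary: S)
  case 0
  then have "S \<inter> {..<n} = {}" by simp
  with 0 show ?case
    unfolding enumerate_0 by (intro Least_equality) (auto simp: not_less[symmetric])
next
  case (Suc i)
  let ?l = "LEAST n. n \<in> S"
  have "S \<inter> {..<n} \<noteq> {}" using Suc.prems by auto
  then have l: "?l \<in> S" "?l < n"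
    using LeastI[of "\<lambda>n. n \<in> S"] Least_le[of "\<lambda>n. n \<in> S"] by (auto intro: le_less_trans)
  then have "(S - {?l}) \<inter> {..<n} = S \<inter> {..<n} - {?l}" "?l \<in> S \<inter> {..<n}" by auto
  then have "card ((S - {?l}) \<inter> {..<n}) = i"
    using Suc.prems by (simp add: card_Diff_singleton)
  with Suc.IH[of "S - {?l}"] Suc.prems l show ?case
    by (simp add: enumerate_Suc)
qed

text \<open>
  Enumerating past the end of a finite set returns one fixed default value. This makes the
  exceptional event on which the random set has too few elements measurable in a trivial way.
\<close>

lemma enumerate_eq_enumerate_empty:
  fixes S :: "nat set"
  assumes "\<And>n. n \<in> S \<Longrightarrow> card (S \<inter> {..<n}) \<noteq> i"
  shows "enumerate S i = enumerate {} 0"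
  using assms
proof (induction i arbitrary: S)
  case 0
  have "S = {}"
  proof (rule ccontr)
    assume "S \<noteq> {}"
    then have "(LEAST n. n \<in> S) \<in> S" "S \<inter> {..<LEAST n. n \<in> S} = {}"
      by (auto intro: LeastI dest: not_less_Least)
    with 0 show False by fastforce
  qed
  then show ?case by simp
next
  case (Suc i)
  let ?l = "LEAST n. n \<in> S"
  have "card ((S - {?l}) \<inter> {..<n}) \<noteq> i" if n: "n \<in> S - {?l}" for n
  proof -
    have "?l \<in> S" "?l \<le> n" using n by (auto intro: LeastI Least_le)
    then have "S \<inter> {..<n} = insert ?l ((S - {?l}) \<inter> {..<n})"
      using n by (auto simp: le_less)
    then have "card (S \<inter> {..<n}) = Suc (card ((S - {?l}) \<inter> {..<n}))"
      by (metis (no_types, lifting) Diff_iff IntD1 card_insert_disjoint finite_Int finite_lessThan insertI1)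
    with Suc.prems[of n] n show ?thesis by auto
  qed
  then show ?case
    by (subst enumerate_Suc) (rule Suc.IH)
qed

section \<open>Counting the elements of a URI-set\<close>

text \<open>
  Passing from events to indicator variables gives access to the independence of one variable from
  the sum of others. It holds since the indicator of \<open>A i\<close> only generates \<open>A i\<close> and its complement.
\<close>

lemma (in prob_space) indep_vars_indicator:
  assumes "indep_events A I"
  shows "indep_vars (\<lambda>_. borel) (\<lambda>i. indicator (A i) :: 'a \<Rightarrow> real) I"
  unfolding indep_vars_def2
proof (intro conjI ballI)
  have A: "A i \<in> events" if "i \<in> I" for i
    using assms that by (auto simp: indep_events_def)
  then show "random_variable borel (indicator (A i) :: 'a \<Rightarrow> real)" if "i \<in> I" for i
    using that by (intro borel_measurable_indicator)
  have "indep_sets (\<lambda>i. sigma_sets (space M) {A i}) I"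
    using assms unfolding indep_events_def_alt
    by (rule indep_sets_sigma) (simp add: Int_stable_def)
  then show "indep_sets (\<lambda>i. {(indicator (A i) :: 'a \<Rightarrow> real) -` B \<inter> space M |B. B \<in> sets borel}) I"
  proof (rule indep_sets_mono_sets)
    fix i assume i: "i \<in> I"
    show "{(indicator (A i) :: 'a \<Rightarrow> real) -` B \<inter> space M |B. B \<in> sets borel} \<subseteq> sigma_sets (space M) {A i}"
    proof safe
      fix B :: "real set"
      have sub: "A i \<subseteq> space M" using A[OF i] by (rule sets.sets_into_space)
      have in1: "A i \<in> sigma_sets (space M) {A i}" by auto
      have "(indicator (A i) :: 'a \<Rightarrow> real) -` B \<inter> space M =
          (if 1 \<in> B then if 0 \<in> B then space M else A i else if 0 \<in> B then space M - A i else {})"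
      proof (rule set_eqI)
        show "x \<in> (indicator (A i) :: 'a \<Rightarrow> real) -` B \<inter> space M \<longleftrightarrow>
            x \<in> (if 1 \<in> B then if 0 \<in> B then space M else A i else if 0 \<in> B then space M - A i else {})" for x
          using sub by (cases "x \<in> A i") auto
      qed
      then show "(indicator (A i) :: 'a \<Rightarrow> real) -` B \<inter> space M \<in> sigma_sets (space M) {A i}"
        using in1 by (simp add: sigma_sets_top sigma_sets.Empty sigma_sets.Compl)
    qed
  qed
qed

context URI_set
begin

lemma mem_event [measurable]: "n \<ge> 1 \<Longrightarrow> {\<omega> \<in> space M. n \<in> E \<omega>} \<in> events"
  using indep by (auto simp: indep_events_def)

lemma card_eq_sum_indicator:
  assumes "\<omega> \<in> space M"
  shows "real (card (E \<omega> \<inter> {1..n})) = (\<Sum>i\<in>{1..n}. indicator {\<omega> \<in> space M. i \<in> E \<omega>} \<omega>)"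
proof -
  have "(\<Sum>i\<in>{1..n}. indicator {\<omega> \<in> space M. i \<in> E \<omega>} \<omega>) = (\<Sum>i\<in>{1..n}. indicator (E \<omega>) i :: real)"
    using assms by (intro sum.cong) (auto simp: indicator_def)
  then show ?thesis by (simp add: indicator_def sum_of_bool_eq Int_commute)
qed

lemma count_event_alt:
  "{\<omega> \<in> space M. card (E \<omega> \<inter> {1..n}) = k} =
    (\<lambda>\<omega>. \<Sum>i\<in>{1..n}. indicator {\<omega> \<in> space M. i \<in> E \<omega>} \<omega> :: real) -` {real k} \<inter> space M"
proof -
  have "card (E \<omega> \<inter> {1..n}) = k \<longleftrightarrow>
      (\<Sum>i\<in>{1..n}. indicator {\<omega> \<in> space M. i \<in> E \<omega>} \<omega>) = real k"
    if "\<omega> \<in> space M" for \<omega>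
    unfolding card_eq_sum_indicator[OF that, symmetric] by simp
  then show ?thesis by blast
qed

lemma count_event [measurable]: "{\<omega> \<in> space M. card (E \<omega> \<inter> {1..n}) = k} \<in> events"
  unfolding count_event_alt
  by (intro measurable_sets[where A = borel] borel_measurable_sum borel_measurable_indicator mem_event) auto

text \<open>
  Both the membership of \<open>n + 1\<close> and its failure are independent of the number of smaller elements;
  the two cases correspond to the two terms in the recursion for \<open>count_prob\<close>.
\<close>

lemma indep_count_mem:
  defines "A \<equiv> \<lambda>i. {\<omega> \<in> space M. i \<in> E \<omega>}"
  assumes "X \<in> {A (Suc n), space M - A (Suc n)}"
  shows "prob (X \<inter> {\<omega> \<in> space M. card (E \<omega> \<inter> {1..n}) = k}) =
    prob X * prob {\<omega> \<in> space M. card (E \<omega> \<inter> {1..n}) = k}"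
proof -
  let ?C = "{\<omega> \<in> space M. card (E \<omega> \<inter> {1..n}) = k}"
  have "indep_vars (\<lambda>_. borel) (\<lambda>i. indicator (A i) :: 'a \<Rightarrow> real) (insert (Suc n) {1..n})"
    using indep_vars_indicator[OF indep] unfolding A_def
    by (rule indep_vars_subset) auto
  then have "indep_var borel (indicator (A (Suc n)) :: 'a \<Rightarrow> real) borel (\<lambda>\<omega>. \<Sum>i\<in>{1..n}. indicator (A i) \<omega>)"
    by (intro indep_vars_sum) auto
  note ind = indep_varD[OF this]
  have main: "prob (X \<inter> ?C) = prob X * prob ?C"
    if X: "X = (indicator (A (Suc n)) :: 'a \<Rightarrow> real) -` {b} \<inter> space M" for b
  proof -
    let ?S = "\<lambda>\<omega>. \<Sum>i\<in>{1..n}. indicator (A i) \<omega> :: real"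
    have C: "?C = ?S -` {real k} \<inter> space M"
      unfolding A_def by (rule count_event_alt)
    have "(\<lambda>\<omega>. (indicator (A (Suc n)) \<omega> :: real, ?S \<omega>)) -` ({b} \<times> {real k}) \<inter> space M =
        indicator (A (Suc n)) -` {b} \<inter> space M \<inter> (?S -` {real k} \<inter> space M)"
      by auto
    with ind[of "{b}" "{real k}"] show ?thesis
      unfolding C X by simp
  qed
  have "A (Suc n) = (indicator (A (Suc n)) :: 'a \<Rightarrow> real) -` {1} \<inter> space M"
      "space M - A (Suc n) = (indicator (A (Suc n)) :: 'a \<Rightarrow> real) -` {0} \<inter> space M"
    by (auto simp: A_def indicator_def)
  then have "X = (indicator (A (Suc n)) :: 'a \<Rightarrow> real) -` {1} \<inter> space M \<or>
      X = (indicator (A (Suc n)) :: 'a \<Rightarrow> real) -` {0} \<inter> space M"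
    using assms(2) by blast
  then show ?thesis
    using main by blast
qed

lemma prob_count: "prob {\<omega> \<in> space M. card (E \<omega> \<inter> {1..n}) = k} = count_prob n k"
proof (induction n arbitrary: k)
  case 0
  then show ?case by (simp add: count_prob_0 prob_space)
next
  case (Suc n)
  let ?A = "{\<omega> \<in> space M. Suc n \<in> E \<omega>}"
  let ?C = "\<lambda>k. {\<omega> \<in> space M. card (E \<omega> \<inter> {1..n}) = k}"
  have A: "?A \<in> events" "prob ?A = 1 / real (Suc n)" "prob (space M - ?A) = 1 - 1 / real (Suc n)"
    using prob_mem[of "Suc n"] prob_compl[of ?A] mem_event[of "Suc n"] by simp_all
  have card: "card (E \<omega> \<inter> {1..Suc n}) = (if Suc n \<in> E \<omega> then 1 else 0) + card (E \<omega> \<inter> {1..n})" for \<omega>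
    by (auto simp: atLeastAtMostSuc_conv Int_insert_right)
  show ?case
  proof (cases k)
    case 0
    have "{\<omega> \<in> space M. card (E \<omega> \<inter> {1..Suc n}) = k} = (space M - ?A) \<inter> ?C 0"
      unfolding card 0 by auto
    then have "prob {\<omega> \<in> space M. card (E \<omega> \<inter> {1..Suc n}) = k} = prob (space M - ?A) * prob (?C 0)"
      using indep_count_mem[of "space M - ?A" n 0] by (simp only:) blast
    also have "\<dots> = (1 - 1 / real (Suc n)) * count_prob n 0"
      by (simp only: A Suc.IH)
    finally have "prob {\<omega> \<in> space M. card (E \<omega> \<inter> {1..Suc n}) = k} = (1 - 1 / real (Suc n)) * count_prob n 0" .
    then show ?thesis
      by (cases n) (simp_all add: 0 count_prob_Suc_0)
  next
    case (Suc j)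
    have split: "{\<omega> \<in> space M. card (E \<omega> \<inter> {1..Suc n}) = k} = ((space M - ?A) \<inter> ?C (Suc j)) \<union> (?A \<inter> ?C j)"
      unfolding card Suc by auto
    have "prob {\<omega> \<in> space M. card (E \<omega> \<inter> {1..Suc n}) = k} = prob ((space M - ?A) \<inter> ?C (Suc j)) + prob (?A \<inter> ?C j)"
      unfolding split using A(1) by (intro finite_measure_Union sets.Int sets.compl_sets count_event) auto
    also have "\<dots> = (1 - 1 / real (Suc n)) * count_prob n (Suc j) + 1 / real (Suc n) * count_prob n j"
      using indep_count_mem[of "space M - ?A" n "Suc j"] indep_count_mem[of ?A n j] A Suc.IH by simp
    finally show ?thesis by (simp only: Suc count_prob_Suc_Suc)
  qed
qed

section \<open>The law of the elements of a URI-set\<close>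

text \<open>
  The event that \<open>N\<^sub>k\<^sub>+\<^sub>1 = i + 1\<close>: both indices are shifted so that they range over all natural
  numbers.
\<close>

definition nth_event :: "nat \<Rightarrow> nat \<Rightarrow> 'a set" where
  "nth_event k i = {\<omega> \<in> space M. Suc i \<in> E \<omega> \<and> card (E \<omega> \<inter> {1..i}) = k}"

lemma nth_event_alt:
  "nth_event k i = {\<omega> \<in> space M. Suc i \<in> E \<omega>} \<inter> {\<omega> \<in> space M. card (E \<omega> \<inter> {1..i}) = k}"
  by (auto simp: nth_event_def)

lemma nth_event_events [measurable]: "nth_event k i \<in> events"
  unfolding nth_event_alt by (intro sets.Int mem_event count_event) simp

lemma prob_nth_event: "prob (nth_event k i) = count_prob i k / real (Suc i)"
  using indep_count_mem[of "{\<omega> \<in> space M. Suc i \<in> E \<omega>}" i k]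
  unfolding nth_event_alt prob_count by (simp add: prob_mem)

lemma URI_nth_eq_if_nth_event:
  assumes "\<omega> \<in> nth_event k i"
  shows "URI_nth E (Suc k) \<omega> = Suc i"
proof -
  have "E \<omega> \<inter> {..<Suc i} = E \<omega> \<inter> {1..i}"
  proof -
    have "n \<ge> 1" if "n \<in> E \<omega>" for n
      using assms positive[of \<omega>] that by (cases n) (auto simp: nth_event_def)
    then show ?thesis by auto
  qed
  then show ?thesis
    unfolding URI_nth_def using assms
    by (intro enumerate_eq_if_card) (simp_all add: nth_event_def)
qed

lemma URI_nth_default:
  assumes "\<omega> \<in> space M" "\<And>i. \<omega> \<notin> nth_event k i"
  shows "URI_nth E (Suc k) \<omega> = enumerate {} 0"
  unfolding URI_nth_def
proof (subst diff_Suc_1, rule enumerate_eq_enumerate_empty)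
  fix n assume n: "n \<in> E \<omega>"
  have pos: "m \<ge> 1" if "m \<in> E \<omega>" for m
    using assms positive[of \<omega>] that by (cases m) auto
  obtain i where i: "n = Suc i" using pos[OF n] by (cases n) auto
  have "E \<omega> \<inter> {..<n} = E \<omega> \<inter> {1..i}" using pos i by auto
  then show "card (E \<omega> \<inter> {..<n}) \<noteq> k"
    using assms n i by (auto simp: nth_event_def)
qed

lemma disjoint_nth_event: "disjoint_family (nth_event k)"
proof (unfold disjoint_family_on_def, intro ballI impI)
  fix i j :: nat assume "i \<noteq> j"
  moreover have "i = j" if "\<omega> \<in> nth_event k i" "\<omega> \<in> nth_event k j" for \<omega>
    using that[THEN URI_nth_eq_if_nth_event] by simp
  ultimately show "nth_event k i \<inter> nth_event k j = {}"
    by blast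
qed

text \<open>
  Almost surely there is a \<open>(k+1)\<close>-st element, because the probabilities of its possible values
  add up to \<open>1\<close>.
\<close>

lemma nth_event_exhausts: "prob (space M - (\<Union>i. nth_event k i)) = 0"
proof -
  have "(\<lambda>i. prob (nth_event k i)) sums prob (\<Union>i. nth_event k i)"
    by (intro finite_measure_UNION disjoint_nth_event) auto
  then have "prob (\<Union>i. nth_event k i) = 1"
    using sums_unique2[OF _ count_prob_weighted_sums_1[of k]] by (simp only: prob_nth_event)
  then show ?thesis
    by (subst prob_compl) auto
qed

text \<open>
  The law of \<open>N\<^sub>k\<^sub>+\<^sub>1\<close>. When the default value of the enumeration satisfies \<open>P\<close>, the event also
  contains the outcomes without a \<open>(k+1)\<close>-st element, which form a null set.
\<close>

lemma prob_URI_nth_sums: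
  "(\<lambda>i. if P (Suc i) then count_prob i k / real (Suc i) else 0) sums
    prob {\<omega> \<in> space M. P (URI_nth E (Suc k) \<omega>)}"
proof -
  define B where "B = (\<lambda>i. if P (Suc i) then nth_event k i else {})"
  define F where "F = (if P (enumerate {} 0) then space M - (\<Union>i. nth_event k i) else {})"
  have eq: "{\<omega> \<in> space M. P (URI_nth E (Suc k) \<omega>)} = (\<Union>i. B i) \<union> F"
  proof (intro set_eqI)
    fix \<omega>
    show "\<omega> \<in> {\<omega> \<in> space M. P (URI_nth E (Suc k) \<omega>)} \<longleftrightarrow> \<omega> \<in> (\<Union>i. B i) \<union> F"
    proof (cases "\<exists>i. \<omega> \<in> nth_event k i")
      case True
      then obtain i where i: "\<omega> \<in> nth_event k i" by blast
      then have "\<omega> \<in> space M" by (simp add: nth_event_def)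
      have "\<omega> \<in> nth_event k j \<longleftrightarrow> j = i" for j
        using URI_nth_eq_if_nth_event[of \<omega> k j] URI_nth_eq_if_nth_event[OF i] i by auto
      then have "\<omega> \<in> (\<Union>i. B i) \<longleftrightarrow> P (Suc i)"
        by (simp add: B_def if_distrib[of "\<lambda>X. \<omega> \<in> X"])
      moreover have "\<omega> \<notin> F"
        using i by (auto simp: F_def)
      ultimately show ?thesis
        using URI_nth_eq_if_nth_event[OF i] \<open>\<omega> \<in> space M\<close> by simp
    next
      case False
      then have "\<omega> \<notin> (\<Union>i. B i)"
        by (simp add: B_def)
      with False show ?thesis
        using URI_nth_default[of \<omega> k] by (auto simp: F_def)
    qed
  qed
  have B: "range B \<subseteq> events" unfolding B_def by auto
  have F: "F \<in> null_sets M"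
    using nth_event_exhausts[of k] unfolding F_def
    by (auto simp: null_sets_def emeasure_eq_measure)
  have "disjoint_family B"
    using disjoint_nth_event[of k] unfolding B_def disjoint_family_on_def by auto
  with B have "(\<lambda>i. prob (B i)) sums prob (\<Union>i. B i)"
    by (rule finite_measure_UNION)
  moreover have "prob (B i) = (if P (Suc i) then count_prob i k / real (Suc i) else 0)" for i
    by (simp add: B_def prob_nth_event)
  moreover have "prob ((\<Union>i. B i) \<union> F) = prob (\<Union>i. B i)"
    using B F by (intro measure_Un_null_set) auto
  ultimately show ?thesis by (simp add: eq)
qed

end

section \<open>Convergence to Benford's law\<close>

text \<open>
  For large \<open>k\<close> all values \<open>count_prob n k\<close> are small, uniformly in \<open>n\<close>: they vanish for \<open>n < k\<close>,
  and for \<open>n \<ge> k\<close> the whole row \<open>n\<close> is small. The distance to Benford's law is then small as well.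
\<close>

theorem theorem5p1:
  fixes M :: "'a measure" and E :: "'a \<Rightarrow> nat set" and \<alpha> \<beta> :: real
  assumes "URI_set M E"
    and "1 \<le> \<alpha>" and "\<alpha> < \<beta>" and "\<beta> < 10"
  shows "(\<lambda>k. measure M {\<omega> \<in> space M. decimal_mantissa (real (URI_nth E k \<omega>)) \<in> {\<alpha>..\<beta>}})
           \<longlonglongrightarrow> measure benford {\<alpha>..\<beta>}"
proof -
  interpret URI_set M E by fact
  define p where
    "p k = prob {\<omega> \<in> space M. decimal_mantissa (real (URI_nth E k \<omega>)) \<in> {\<alpha>..\<beta>}}" for k
  have "(\<lambda>k. p (Suc k)) \<longlonglongrightarrow> log 10 \<beta> - log 10 \<alpha>"
  proof (rule LIMSEQ_I)
    fix r :: real assume r: "r > 0"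
    \<comment> \<open>any constant larger than \<open>39\<close> serves to make the final inequality strict\<close>
    have "\<forall>\<^sub>F k in sequentially. \<forall>n j. n \<ge> k \<longrightarrow> count_prob n j \<le> r / 40"
      using r by (intro count_prob_uniformly_small) simp
    then obtain K where K: "\<And>k n. k \<ge> K \<Longrightarrow> n \<ge> k \<Longrightarrow> count_prob n k \<le> r / 40"
      unfolding eventually_sequentially by blast
    have "norm (p (Suc k) - (log 10 \<beta> - log 10 \<alpha>)) < r" if k: "k \<ge> max K 1" for k
    proof -
      have small: "count_prob n k \<le> r / 40" for n
        using K[of k n] k r by (cases "k \<le> n") (auto simp: count_prob_eq_0)
      have "\<bar>p (Suc k) - (log 10 \<beta> - log 10 \<alpha>)\<bar> \<le> 39 * (r / 40)"
        using assms k prob_URI_nth_sums[of "\<lambda>n. decimal_mantissa (real n) \<in> {\<alpha>..\<beta>}" k] unfolding p_def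
        by (intro weighted_count_prob_Benford[OF _ _ _ _ small]) auto
      also have "\<dots> < r" using r by simp
      finally show ?thesis by simp
    qed
    then show "\<exists>no. \<forall>k\<ge>no. norm (p (Suc k) - (log 10 \<beta> - log 10 \<alpha>)) < r" by blast
  qed
  then have "p \<longlonglongrightarrow> log 10 \<beta> - log 10 \<alpha>"
    by (simp only: filterlim_sequentially_Suc)
  then show ?thesis
    using measure_benford_Icc[of \<alpha> \<beta>] assms unfolding p_def by simp
qed

end
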